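(* Every graph without isolated, unlooped vertices is (isomorphic to) the touch-graph $Tch(P)$ of some circuit partition $P$ in some 4-regular graph $F$.
   Context: Graphs are finite, may have loops and parallel edges, and need not be connected. In a 4-regular graph every vertex has exactly four incident half-edges (a loop contributes two). A closed trail is a closed walk with no repeated edge (vertices may repeat). A circuit partition $P$ of a 4-regular graph $F$ is a partition of $E(F)$ into pairwise disjoint subsets, each of which is the edge-set of a closed trail in $F$. The touch-graph $Tch(P)$ has a vertex for each element of $P$ and an edge for each vertex of $F$; the edge corresponding to $v\in V(F)$ is incident on the vertex or vertices corresponding to the element(s) of $P$ incident at $v$ (it is a loop if only one element of $P$ is incident at $v$). *)

theory Defs
  imports Main "HOL-Library.Disjoint_Sets"
begin

text \<open>
  Undirected graphs with loops and parallel edges. The set \<open>ends G e\<close> holds the end-vertices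
  of the edge \<open>e\<close>: it is \<open>{v}\<close> if \<open>e\<close> is a loop at \<open>v\<close>, and has two elements otherwise.
  The values of \<open>ends G\<close> outside \<open>edges G\<close> are irrelevant.
\<close>

record ('v, 'e) mgraph =
  verts :: "'v set"
  edges :: "'e set"
  ends :: "'e \<Rightarrow> 'v set"

definition multigraph :: "('v, 'e) mgraph \<Rightarrow> bool" where
  "multigraph G \<longleftrightarrow> finite (verts G) \<and> finite (edges G) \<and>
     (\<forall>e\<in>edges G. ends G e \<subseteq> verts G \<and> card (ends G e) \<in> {1, 2})"

definition looped :: "('v, 'e) mgraph \<Rightarrow> 'v \<Rightarrow> bool" where
  "looped G v \<longleftrightarrow> (\<exists>e\<in>edges G. ends G e = {v})"

text \<open>An isolated vertex has no neighbour other than itself; it may carry loops.\<close>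

definition isolated :: "('v, 'e) mgraph \<Rightarrow> 'v \<Rightarrow> bool" where
  "isolated G v \<longleftrightarrow> (\<forall>e\<in>edges G. v \<in> ends G e \<longrightarrow> ends G e = {v})"

text \<open>The number of half-edges at \<open>v\<close>: loops are counted in both summands.\<close>

definition degree :: "('v, 'e) mgraph \<Rightarrow> 'v \<Rightarrow> nat" where
  "degree G v = card {e \<in> edges G. v \<in> ends G e} + card {e \<in> edges G. ends G e = {v}}"

definition four_regular :: "('v, 'e) mgraph \<Rightarrow> bool" where
  "four_regular G \<longleftrightarrow> multigraph G \<and> (\<forall>v\<in>verts G. degree G v = 4)"

fun walk :: "('v, 'e) mgraph \<Rightarrow> 'v \<Rightarrow> 'e list \<Rightarrow> 'v \<Rightarrow> bool" where
  "walk G u [] v \<longleftrightarrow> u \<in> verts G \<and> u = v"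
| "walk G u (e # es) v \<longleftrightarrow> e \<in> edges G \<and> (\<exists>w. ends G e = {u, w} \<and> walk G w es v)"

definition closed_trail :: "('v, 'e) mgraph \<Rightarrow> 'e list \<Rightarrow> bool" where
  "closed_trail G es \<longleftrightarrow> distinct es \<and> (\<exists>v. walk G v es v)"

definition circuit_partition :: "('v, 'e) mgraph \<Rightarrow> 'e set set \<Rightarrow> bool" where
  "circuit_partition F P \<longleftrightarrow>
     partition_on (edges F) P \<and> (\<forall>C\<in>P. \<exists>es. closed_trail F es \<and> C = set es)"

definition incident_at :: "('v, 'e) mgraph \<Rightarrow> 'e set \<Rightarrow> 'v \<Rightarrow> bool" where
  "incident_at F C v \<longleftrightarrow> (\<exists>e\<in>C. v \<in> ends F e)"

text \<open>
  A closed trail uses an even number of half-edges at each vertex, so at most two elements of a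
  circuit partition of a 4-regular graph are incident at any vertex.
\<close>

definition touch_graph :: "('v, 'e) mgraph \<Rightarrow> 'e set set \<Rightarrow> ('e set, 'v) mgraph" where
  "touch_graph F P =
     \<lparr>verts = P, edges = verts F, ends = (\<lambda>v. {C \<in> P. incident_at F C v})\<rparr>"

definition isomorphic :: "('v, 'e) mgraph \<Rightarrow> ('w, 'f) mgraph \<Rightarrow> bool" where
  "isomorphic G H \<longleftrightarrow> (\<exists>f g. bij_betw f (verts G) (verts H) \<and> bij_betw g (edges G) (edges H) \<and>
     (\<forall>e\<in>edges G. ends H (g e) = f ` ends G e))"

end

theory Submission
  imports Defs
begin

text \<open>
  Cut every edge of \<open>G\<close> into two half-edges, and arrange the half-edges at each vertex of \<open>G\<close> in a
  cyclic order; let \<open>s\<close> be the permutation that sends each half-edge to its successor. In \<open>F\<close> the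
  vertices are the edges of \<open>G\<close> and the edges are the half-edges of \<open>G\<close>: the half-edge \<open>h\<close> joins the
  edge of \<open>G\<close> to which \<open>h\<close> belongs to the one to which \<open>s h\<close> belongs. A vertex of \<open>F\<close> is an
  edge of \<open>G\<close> and so has two halves \<open>h\<close>. Orienting each edge \<open>h\<close> of \<open>F\<close> from \<open>h\<close> to \<open>s h\<close>, one
  edge leaves the vertex and one enters it for each half, so its degree is four
  (\<open>degree_successor_graph\<close>).

  Running once around the cyclic order at a vertex \<open>v\<close> of \<open>G\<close> traverses a closed trail of \<open>F\<close> whose
  edges are the half-edges at \<open>v\<close> (\<open>closed_trail_cycle\<close>). These trails partition the edges of \<open>F\<close>;
  none of them is empty, because the assumption on \<open>G\<close> says that every vertex has at least one
  half-edge. The trail of \<open>v\<close> passes through the vertex \<open>e\<close> of \<open>F\<close> exactly if some half of \<open>e\<close> is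
  attached to \<open>v\<close>, that is, if \<open>v\<close> is an end of \<open>e\<close> in \<open>G\<close>. Hence the touch-graph is \<open>G\<close>.
\<close>

section \<open>Cyclic orders\<close>

definition cycles_through :: "('a \<Rightarrow> 'a) \<Rightarrow> 'a set \<Rightarrow> bool" where
  "cycles_through s A \<longleftrightarrow>
     (\<exists>f n. bij_betw f {..<n} A \<and> (\<forall>i<n. s (f i) = f (Suc i mod n)))"

lemma ex_cycles_through:
  assumes "finite A"
  shows "\<exists>s. cycles_through s A"
proof -
  obtain f where f: "bij_betw f {..<card A} A"
    using ex_bij_betw_nat_finite[OF assms] by (auto simp: atLeast0LessThan)
  define s where "s = (\<lambda>x. f (Suc (inv_into {..<card A} f x) mod card A))"
  have "s (f i) = f (Suc i mod card A)" if "i < card A" for i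
    using f that by (simp add: s_def bij_betw_def)
  with f show ?thesis
    unfolding cycles_through_def by blast
qed

lemma image_cycles_through:
  assumes "cycles_through s A"
  shows "s ` A = A"
proof -
  obtain f n where f: "bij_betw f {..<n} A" and s: "\<forall>i<n. s (f i) = f (Suc i mod n)"
    using assms unfolding cycles_through_def by blast
  have A: "A = f ` {..<n}"
    using f by (simp add: bij_betw_def)
  have "(\<lambda>i. Suc i mod n) ` {..<n} = {..<n}"
  proof (intro equalityI subsetI)
    fix j assume "j \<in> (\<lambda>i. Suc i mod n) ` {..<n}"
    then show "j \<in> {..<n}" by auto
  next
    fix j assume j: "j \<in> {..<n}"
    \<comment> \<open>the predecessor of \<open>0\<close> is \<open>n - 1\<close>\<close>
    have "Suc (if j = 0 then n - 1 else j - 1) mod n = j"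
      using j by auto
    then show "j \<in> (\<lambda>i. Suc i mod n) ` {..<n}"
      using j by (intro image_eqI[of _ _ "if j = 0 then n - 1 else j - 1"]) auto
  qed
  moreover have "s ` A = f ` (\<lambda>i. Suc i mod n) ` {..<n}"
    unfolding A image_image using s by (intro image_cong) auto
  ultimately show ?thesis
    by (simp add: A)
qed

text \<open>The cyclic orders on the fibres of \<open>a\<close> are glued together into one permutation.\<close>

lemma ex_fibrewise_cycles:
  assumes "finite H"
  obtains s where "bij_betw s H H" and "\<And>v. cycles_through s {h \<in> H. a h = v}"
proof -
  let ?C = "\<lambda>v. {h \<in> H. a h = v}"
  have "\<forall>v. \<exists>s. cycles_through s (?C v)"
    using assms by (intro allI ex_cycles_through) simp
  then obtain S where S: "\<And>v. cycles_through (S v) (?C v)"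
    using choice[of "\<lambda>v s. cycles_through s (?C v)"] by blast
  define s where "s = (\<lambda>h. S (a h) h)"
  have s: "cycles_through s (?C v)" for v
  proof -
    obtain f n where f: "bij_betw f {..<n} (?C v)"
      and "\<forall>i<n. S v (f i) = f (Suc i mod n)"
      using S[of v] unfolding cycles_through_def by blast
    moreover have "a (f i) = v" if "i < n" for i
      using f that by (auto simp: bij_betw_def)
    ultimately have "\<forall>i<n. s (f i) = f (Suc i mod n)"
      by (simp add: s_def)
    with f show ?thesis
      unfolding cycles_through_def by blast
  qed
  have "s ` (\<Union>v. ?C v) = (\<Union>v. ?C v)"
    by (simp only: image_UN image_cycles_through[OF s])
  moreover have "(\<Union>v. ?C v) = H"
    by blast
  ultimately have "s ` H = H"
    by simp
  then have "bij_betw s H H"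
    using assms by (simp add: bij_betw_def eq_card_imp_inj_on)
  then show ?thesis
    using s by (rule that)
qed

section \<open>The graph of a permutation of half-edges\<close>

text \<open>
  Here \<open>H\<close> is the set of half-edges, \<open>p h\<close> is the edge to which \<open>h\<close> belongs, and \<open>s\<close> is the
  successor permutation.
\<close>

definition successor_graph :: "('h \<Rightarrow> 'e) \<Rightarrow> ('h \<Rightarrow> 'h) \<Rightarrow> 'h set \<Rightarrow> ('e, 'h) mgraph" where
  "successor_graph p s H = \<lparr>verts = p ` H, edges = H, ends = (\<lambda>h. {p h, p (s h)})\<rparr>"

text \<open>
  By inclusion and exclusion, the degree of \<open>e\<close> counts the half-edges \<open>h\<close> with \<open>p h = e\<close> and those
  with \<open>p (s h) = e\<close>; the bijection \<open>s\<close> shows that there are equally many of each kind.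
\<close>

lemma degree_successor_graph:
  assumes "finite H" "bij_betw s H H"
  shows "degree (successor_graph p s H) e = 2 * card {h \<in> H. p h = e}"
proof -
  let ?A = "{h \<in> H. p h = e}" and ?B = "{h \<in> H. p (s h) = e}"
  have "{h \<in> H. e \<in> {p h, p (s h)}} = ?A \<union> ?B"
    and "{h \<in> H. {p h, p (s h)} = {e}} = ?A \<inter> ?B"
    by auto
  then have "degree (successor_graph p s H) e = card (?A \<union> ?B) + card (?A \<inter> ?B)"
    by (simp only: degree_def successor_graph_def mgraph.simps)
  also have "\<dots> = card ?A + card ?B"
    using card_Un_Int[of ?A ?B] assms(1) by simp
  also have "card ?B = card ?A"
  proof (rule bij_betw_same_card)
    have "s ` ?B = ?A"
      using assms(2) by (auto simp: bij_betw_def image_iff)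
    then show "bij_betw s ?B ?A"
      using assms(2) by (auto simp: bij_betw_def intro: inj_on_subset)
  qed
  finally show ?thesis
    by simp
qed

lemma four_regular_successor_graph:
  assumes "finite H" "bij_betw s H H" "\<And>h. h \<in> H \<Longrightarrow> card {h' \<in> H. p h' = p h} = 2"
  shows "four_regular (successor_graph p s H)"
proof -
  have "card {x, y} \<in> {1, 2}" for x y :: 'b
    by (cases "x = y") auto
  then have "multigraph (successor_graph p s H)"
    using assms(1,2) by (auto simp: multigraph_def successor_graph_def bij_betw_def)
  moreover have "degree (successor_graph p s H) e = 4" if "e \<in> p ` H" for e
    using assms that by (auto simp: degree_successor_graph)
  ultimately show ?thesis
    by (auto simp: four_regular_def successor_graph_def)
qed

lemma closed_trail_cycle:
  assumes "cycles_through s C" "C \<subseteq> H" "C \<noteq> {}"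
  shows "\<exists>es. closed_trail (successor_graph p s H) es \<and> C = set es"
proof -
  let ?F = "successor_graph p s H"
  obtain f n where f: "bij_betw f {..<n} C" and s: "\<forall>i<n. s (f i) = f (Suc i mod n)"
    using assms(1) unfolding cycles_through_def by blast
  have C: "C = f ` {..<n}"
    using f by (simp add: bij_betw_def)
  then have n: "n > 0"
    using assms(3) by auto
  have fH: "f i \<in> H" if "i < n" for i
    using C assms(2) that by auto
  \<comment> \<open>downward induction on \<open>i\<close>; because of \<open>mod\<close>, the empty walk for \<open>i = n\<close> is at the starting vertex\<close>
  have "walk ?F (p (f (i mod n))) (map f [i..<n]) (p (f 0))" if "i \<le> n" for i
    using that
  proof (induction i rule: inc_induct)
    case base
    then show ?case
      using fH n by (simp add: successor_graph_def)
  next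
    case (step i)
    then show ?case
      using s fH by (auto simp: upt_conv_Cons successor_graph_def)
  qed
  from this[of 0] have "walk ?F (p (f 0)) (map f [0..<n]) (p (f 0))"
    by simp
  moreover have "distinct (map f [0..<n])"
    using f by (simp add: distinct_map bij_betw_def atLeast0LessThan)
  ultimately have "closed_trail ?F (map f [0..<n])"
    unfolding closed_trail_def by blast
  moreover have "C = set (map f [0..<n])"
    by (simp add: C atLeast0LessThan)
  ultimately show ?thesis
    by blast
qed

section \<open>Half-edges of a multigraph\<close>

text \<open>
  Numbering the edges as \<open>g 0, \<dots>, g (m - 1)\<close>, the two halves of \<open>g i\<close> get the numbers \<open>2 * i\<close> and
  \<open>2 * i + 1\<close>, and \<open>a h\<close> is the vertex to which the half-edge \<open>h\<close> is attached.
\<close>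

lemma ex_half_edges:
  assumes "multigraph G"
  obtains g :: "nat \<Rightarrow> 'e" and a :: "nat \<Rightarrow> 'v" and m
  where "bij_betw g {..<m} (edges (G :: ('v, 'e) mgraph))"
    and "\<And>i. i < m \<Longrightarrow> ends G (g i) = a ` {h. h div 2 = i}"
proof -
  obtain g where g: "bij_betw g {..<card (edges G)} (edges G)"
    using assms ex_bij_betw_nat_finite[of "edges G"]
    by (auto simp: multigraph_def atLeast0LessThan)
  have "\<exists>x y. ends G (g i) = {x, y}" if "i < card (edges G)" for i
  proof -
    have "g i \<in> edges G"
      using g that by (auto simp: bij_betw_def)
    then have "card (ends G (g i)) = 1 \<or> card (ends G (g i)) = 2"
      using assms by (auto simp: multigraph_def)
    then show ?thesis
      by (auto simp: card_1_singleton_iff card_2_iff)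
  qed
  then obtain x y where xy: "\<And>i. i < card (edges G) \<Longrightarrow> ends G (g i) = {x i, y i}"
    by metis
  define a where "a = (\<lambda>h. if even h then x (h div 2) else y (h div 2))"
  have "{h. h div 2 = i} = {2 * i, 2 * i + 1}" for i :: nat
    by auto
  then have "ends G (g i) = a ` {h. h div 2 = i}" if "i < card (edges G)" for i
    using xy[OF that] by (simp add: a_def insert_commute)
  with g show ?thesis
    by (rule that)
qed

section \<open>Every graph without isolated, unlooped vertices is a touch-graph\<close>

theorem theorem11:
  fixes G :: "('v, 'e) mgraph"
  assumes "multigraph G"
    and "\<not> (\<exists>v\<in>verts G. isolated G v \<and> \<not> looped G v)"
  shows "\<exists>(F :: (nat, nat) mgraph) P.
    four_regular F \<and> circuit_partition F P \<and> isomorphic G (touch_graph F P)"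
proof -
  obtain g and a :: "nat \<Rightarrow> 'v" and m where g: "bij_betw g {..<m} (edges G)"
    and a: "\<And>i. i < m \<Longrightarrow> ends G (g i) = a ` {h. h div 2 = i}"
    by (rule ex_half_edges[OF assms(1)]) (rule that)
  define H :: "nat set" where "H = {..<2 * m}"
  have div2_H: "h div 2 < m \<longleftrightarrow> h \<in> H" for h
    by (auto simp: H_def)
  have g_in: "g i \<in> edges G" if "i < m" for i
    using g that by (auto simp: bij_betw_def)
  have ends_subset: "ends G e \<subseteq> verts G" if "e \<in> edges G" for e
    using assms(1) that by (auto simp: multigraph_def)
  have a_verts: "a h \<in> verts G" if "h \<in> H" for h
    using a[of "h div 2"] ends_subset[OF g_in] div2_H that by blast

  have "finite H"
    by (simp add: H_def)
  then obtain s where s: "bij_betw s H H" and cyc: "\<And>v. cycles_through s {h \<in> H. a h = v}"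
    by (rule ex_fibrewise_cycles[where a = a]) (rule that)
  define F where "F = successor_graph (\<lambda>h. h div 2) s H"
  define C where "C = (\<lambda>v. {h \<in> H. a h = v})"
  define P where "P = C ` verts G"

  have verts_F: "verts F = {..<m}"
  proof -
    have "i \<in> (\<lambda>h. h div 2) ` H" if "i < m" for i
      using that by (intro image_eqI[of _ _ "2 * i"]) (auto simp: H_def)
    then show ?thesis
      using div2_H by (auto simp: F_def successor_graph_def)
  qed

  have "four_regular F"
    unfolding F_def
  proof (rule four_regular_successor_graph)
    fix h assume "h \<in> H"
    then have "{h' \<in> H. h' div 2 = h div 2} = {2 * (h div 2), 2 * (h div 2) + 1}"
      unfolding H_def by auto presburger
    then show "card {h' \<in> H. h' div 2 = h div 2} = 2"
      by simp
  qed (fact \<open>finite H\<close> s)+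

  have C_nonempty: "C v \<noteq> {}" if v: "v \<in> verts G" for v
  proof -
    \<comment> \<open>a loop if \<open>v\<close> is isolated, and an edge to a neighbour otherwise\<close>
    obtain e where e: "e \<in> edges G" "v \<in> ends G e"
      using assms(2) v by (auto simp: isolated_def looped_def)
    then obtain i where "i < m" "e = g i"
      using g by (auto simp: bij_betw_def)
    then obtain h where "h \<in> H" "a h = v"
      using e a div2_H by auto
    then show ?thesis
      by (auto simp: C_def)
  qed
  have inj_C: "inj_on C (verts G)"
    using C_nonempty by (fastforce simp: inj_on_def C_def)
  have "partition_on (edges F) P"
  proof (rule partition_onI)
    show "\<Union>P = edges F"
      using a_verts by (auto simp: P_def C_def F_def successor_graph_def)
  qed (use C_nonempty in \<open>auto simp: P_def C_def disjnt_def\<close>)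
  moreover have "\<exists>es. closed_trail F es \<and> C v = set es" if "v \<in> verts G" for v
    unfolding F_def
    by (rule closed_trail_cycle) (use cyc C_nonempty[OF that] in \<open>auto simp: C_def\<close>)
  ultimately have "circuit_partition F P"
    by (auto simp: circuit_partition_def P_def)

  moreover have "isomorphic G (touch_graph F P)"
    unfolding isomorphic_def
  proof (intro exI conjI ballI)
    show "bij_betw C (verts G) (verts (touch_graph F P))"
      using inj_C by (simp add: bij_betw_def touch_graph_def P_def)
    show "bij_betw (inv_into {..<m} g) (edges G) (edges (touch_graph F P))"
      using bij_betw_inv_into[OF g] by (simp add: touch_graph_def verts_F)
    fix e assume "e \<in> edges G"
    then obtain i where i: "i < m" "e = g i" "inv_into {..<m} g e = i"
      using g by (auto simp: bij_betw_def)
    have "incident_at F (C v) i \<longleftrightarrow> v \<in> ends G e" for v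
    proof -
      have "incident_at F (C v) i \<longleftrightarrow> (\<exists>h\<in>C v. h div 2 = i \<or> s h div 2 = i)"
        by (auto simp: incident_at_def F_def successor_graph_def)
      \<comment> \<open>the cycle \<open>C v\<close> is closed under \<open>s\<close>, so \<open>s h\<close> is again an element of it\<close>
      also have "\<dots> \<longleftrightarrow> (\<exists>h\<in>C v. h div 2 = i)"
        using image_cycles_through[OF cyc[of v]] unfolding C_def by blast
      also have "\<dots> \<longleftrightarrow> v \<in> ends G e"
        using i a[of i] div2_H by (auto simp: C_def)
      finally show ?thesis .
    qed
    then show "ends (touch_graph F P) (inv_into {..<m} g e) = C ` ends G e"
      using ends_subset[OF \<open>e \<in> edges G\<close>] by (auto simp: touch_graph_def P_def i(3))
  qed
  ultimately show ?thesis
    using \<open>four_regular F\<close> by blast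
qed

end
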